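(* $f(321)\ge 333$. Consequently, Borsuk's conjecture fails in every dimension $n\ge 321$, i.e. $f(n)>n+1$ for all $n\ge 321$.
   Context: For $n\ge 1$, $f(n)$ denotes the smallest integer $f$ such that every bounded set in $\mathbb{R}^n$ can be partitioned into at most $f$ subsets each of strictly smaller diameter than the original set. Borsuk's conjecture asserts $f(n)=n+1$ for all $n\ge1$. (It is known from prior work that $f(n)>n+1$ for all $n\ge 323$.) *)

theory Defs
  imports Complex_Main
begin

definition Rn :: "nat \<Rightarrow> (nat \<Rightarrow> real) set" where
  "Rn n = {x. \<forall>i\<ge>n. x i = 0}"

definition edist :: "nat \<Rightarrow> (nat \<Rightarrow> real) \<Rightarrow> (nat \<Rightarrow> real) \<Rightarrow> real" where
  "edist n x y = sqrt (\<Sum>i<n. (x i - y i)^2)"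

definition bounded_n :: "nat \<Rightarrow> (nat \<Rightarrow> real) set \<Rightarrow> bool" where
  "bounded_n n S \<longleftrightarrow> (\<exists>B. \<forall>x\<in>S. \<forall>y\<in>S. edist n x y \<le> B)"

definition diam_n :: "nat \<Rightarrow> (nat \<Rightarrow> real) set \<Rightarrow> real" where
  "diam_n n S = Sup {edist n x y | x y. x \<in> S \<and> y \<in> S}"

definition borsuk_partitionable :: "nat \<Rightarrow> (nat \<Rightarrow> real) set \<Rightarrow> nat \<Rightarrow> bool" where
  "borsuk_partitionable n S k \<longleftrightarrow>
     (\<exists>c :: (nat \<Rightarrow> real) \<Rightarrow> nat. (\<forall>x\<in>S. c x < k) \<and>
        (\<forall>i<k. {x\<in>S. c x = i} = {} \<or> diam_n n {x\<in>S. c x = i} < diam_n n S))"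

text \<open>Borsuk number f(n); sets considered are bounded with at least two points
  (for sets of diameter 0 the question is vacuous/degenerate).\<close>
definition borsuk_f :: "nat \<Rightarrow> nat" where
  "borsuk_f n = (LEAST k. \<forall>S. S \<subseteq> Rn n \<and> bounded_n n S \<and> (\<exists>x\<in>S. \<exists>y\<in>S. x \<noteq> y)
                    \<longrightarrow> borsuk_partitionable n S k)"

end

theory Submission
  imports Defs
begin

text \<open>
  The counterexample is built from Bondarenko's two-distance set. The \<open>G\<^sub>2(4)\<close> graph is strongly
  regular with parameters (416, 100, 36, 20), so its adjacency matrix \<open>A\<close> has eigenvalues 100, 20
  and \<open>-4\<close>, of multiplicities 1, 65 and 350. Hence \<open>A + 4 I\<close> is the Gram matrix of 416 vectors in
  dimension 66, of squared length 4 and with inner products 1 on edges and 0 on non-edges. Adjoin the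
  vectors \<open>2 e\<^sub>j\<close> for \<open>66 \<le> j < n\<close>. The diameter is attained exactly by the orthogonal pairs, so a
  part of smaller diameter is either one of the new vectors or a clique of the graph. Cliques have
  at most 5 vertices, whence \<open>f(n) \<ge> 84 + (n - 66) = n + 18\<close>.
\<close>

section \<open>Diameters and the Borsuk number\<close>


lemma edist_coord_le: "i < n \<Longrightarrow> \<bar>x i - y i\<bar> \<le> edist n x y"
  unfolding edist_def
  by (rule real_le_rsqrt) (simp add: member_le_sum[where f = "\<lambda>i. (x i - y i)^2"])

text \<open>The factor \<open>n\<close> in place of its square root is crude but suffices for a grid
  of mesh \<open>diam S / (n + 1)\<close>.\<close>

lemma edist_le_coord_bound:
  assumes "\<And>i. i < n \<Longrightarrow> \<bar>x i - y i\<bar> \<le> e" and "0 \<le> e"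
  shows "edist n x y \<le> real n * e"
proof -
  have "(\<Sum>i<n. (x i - y i)^2) \<le> (\<Sum>i<n. e^2)"
    using assms by (intro sum_mono) (simp add: abs_le_square_iff[symmetric])
  also have "\<dots> = real n * e^2" by simp
  also have "\<dots> \<le> (real n * e)^2"
  proof (cases n)
    case (Suc m)
    then have "1 \<le> real n" by simp
    then have "real n * 1 \<le> real n * real n" by (intro mult_left_mono) auto
    then have "real n * e^2 \<le> real n * real n * e^2" by (intro mult_right_mono) auto
    then show ?thesis by (simp add: power2_eq_square mult_ac)
  qed simp
  finally show ?thesis
    unfolding edist_def using assms(2) by (intro real_le_lsqrt) auto
qed

lemma edist_pos:
  assumes "x \<in> Rn n" "y \<in> Rn n" "x \<noteq> y"
  shows "0 < edist n x y"
proof -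
  obtain i where i: "x i \<noteq> y i" using assms(3) by blast
  then have "i < n" using assms(1,2) unfolding Rn_def by (force simp: not_less[symmetric])
  from edist_coord_le[OF this, of x y] i show ?thesis by linarith
qed

lemma bdd_above_edist:
  assumes "bounded_n n S"
  shows "bdd_above {edist n x y | x y. x \<in> S \<and> y \<in> S}"
  using assms unfolding bounded_n_def bdd_above_def by blast

lemma edist_le_diam:
  assumes "bounded_n n S" "x \<in> S" "y \<in> S"
  shows "edist n x y \<le> diam_n n S"
  unfolding diam_n_def using assms by (intro cSup_upper bdd_above_edist) auto

lemma diam_le:
  assumes "S \<noteq> {}" "\<And>x y. x \<in> S \<Longrightarrow> y \<in> S \<Longrightarrow> edist n x y \<le> D"
  shows "diam_n n S \<le> D"
  unfolding diam_n_def
proof (rule cSup_least)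
  show "{edist n x y | x y. x \<in> S \<and> y \<in> S} \<noteq> {}" using assms(1) by blast
qed (use assms(2) in auto)

lemma bounded_n_subset: "bounded_n n S \<Longrightarrow> T \<subseteq> S \<Longrightarrow> bounded_n n T"
  unfolding bounded_n_def by blast

text \<open>Without a common bound for all sets, the \<^const>\<open>Least\<close> in \<^const>\<open>borsuk_f\<close> would be a
  junk value. Cells of a grid of mesh \<open>diam S / (n + 1)\<close> give such a bound.\<close>

lemma ex_borsuk_bound:
  "\<exists>k. \<forall>S. S \<subseteq> Rn n \<and> bounded_n n S \<and> (\<exists>x\<in>S. \<exists>y\<in>S. x \<noteq> y) \<longrightarrow> borsuk_partitionable n S k"
proof -
  \<comment> \<open>With \<open>n + 1\<close> subdivisions, points in one cell are at distance at
    most \<open>n * D / (n + 1)\<close>, strictly below \<open>D\<close>.\<close>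
  define m :: int where "m = int n + 1"
  \<comment> \<open>The cell labels do not mention \<open>S\<close>, so their number is a bound
    common to all sets. The value 0 outside \<open>{..<n}\<close> makes them finitely many.\<close>
  define Cells where "Cells = {f. f ` {..<n} \<subseteq> {- m..m} \<and> (\<forall>i. i \<notin> {..<n} \<longrightarrow> f i = 0)}"
  have "finite Cells"
    unfolding Cells_def
    by (rule finite_subset[OF _ finite_set_of_finite_funs[of "{..<n}" "{-m..m}" 0]]) auto
  then obtain g :: "(nat \<Rightarrow> int) \<Rightarrow> nat" where g: "bij_betw g Cells {0..<card Cells}"
    using ex_bij_betw_finite_nat by blast
  have "borsuk_partitionable n S (card Cells)"
    if S: "S \<subseteq> Rn n" "bounded_n n S" and ne: "\<exists>x\<in>S. \<exists>y\<in>S. x \<noteq> y" for S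
  proof -
    obtain x0 y0 where xy: "x0 \<in> S" "y0 \<in> S" "x0 \<noteq> y0" using ne by blast
    define D where "D = diam_n n S"
    have D: "0 < D"
      using edist_pos[of x0 n y0] edist_le_diam[OF S(2) xy(1,2)] xy S(1) unfolding D_def by force
    \<comment> \<open>Coordinates are measured from \<open>x0\<close> in units of
      \<open>D / m\<close>. They differ from those of \<open>x0\<close> by at most \<open>D\<close>,
      so the floors lie in \<open>{-m..m}\<close>.\<close>
    define cell where
      "cell x = (\<lambda>i. if i < n then \<lfloor>(x i - x0 i) * real_of_int m / D\<rfloor> else 0)" for x :: "nat \<Rightarrow> real"
    have m: "0 < m" unfolding m_def by simp
    have cell: "cell x \<in> Cells" if "x \<in> S" for x
    proof -
      have "\<lfloor>(x i - x0 i) * real_of_int m / D\<rfloor> \<in> {-m..m}" if "i < n" for i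
      proof -
        have "\<bar>x i - x0 i\<bar> \<le> D"
          using edist_coord_le[OF that, of x x0] edist_le_diam[OF S(2) \<open>x \<in> S\<close> xy(1)]
          unfolding D_def by linarith
        then have "\<bar>(x i - x0 i) / D\<bar> \<le> 1" using D by (simp add: abs_divide)
        then have "\<bar>(x i - x0 i) / D\<bar> * real_of_int m \<le> 1 * real_of_int m"
          using m by (intro mult_right_mono) auto
        then have "\<bar>(x i - x0 i) * real_of_int m / D\<bar> \<le> real_of_int m"
          using m by (simp add: abs_mult abs_divide)
        then have "- real_of_int m \<le> (x i - x0 i) * real_of_int m / D"
          "(x i - x0 i) * real_of_int m / D \<le> real_of_int m" by linarith+
        then show ?thesis by (simp add: le_floor_iff floor_le_iff)
      qed
      then show ?thesis unfolding Cells_def cell_def by auto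
    qed
    have close: "edist n x y \<le> real n * (D / real_of_int m)" if "cell x = cell y" for x y
    proof (rule edist_le_coord_bound)
      fix i assume "i < n"
      then have "\<lfloor>(x i - x0 i) * real_of_int m / D\<rfloor> = \<lfloor>(y i - x0 i) * real_of_int m / D\<rfloor>"
        using fun_cong[OF that, of i] by (simp add: cell_def)
      then have "\<bar>(x i - x0 i) * real_of_int m / D - (y i - x0 i) * real_of_int m / D\<bar> \<le> 1"
        by linarith
      also have "(x i - x0 i) * real_of_int m / D - (y i - x0 i) * real_of_int m / D
          = (x i - y i) * real_of_int m / D"
        by (simp add: diff_divide_distrib[symmetric] left_diff_distrib[symmetric])
      finally show "\<bar>x i - y i\<bar> \<le> D / real_of_int m"
        using D m by (simp add: abs_mult abs_divide pos_divide_le_eq pos_le_divide_eq)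
    qed (use D m in auto)
    have small: "real n * (D / real_of_int m) < D"
      using D m by (simp add: m_def field_simps)
    show ?thesis unfolding borsuk_partitionable_def
    proof (intro exI[of _ "g \<circ> cell"] conjI ballI allI impI)
      show "(g \<circ> cell) x < card Cells" if "x \<in> S" for x
        using bij_betwE[OF g] cell[OF that] by simp
      fix i assume "i < card Cells"
      show "{x \<in> S. (g \<circ> cell) x = i} = {} \<or> diam_n n {x \<in> S. (g \<circ> cell) x = i} < diam_n n S"
      proof (cases "{x \<in> S. (g \<circ> cell) x = i} = {}")
        case False
        have "cell x = cell y" if "x \<in> S" "y \<in> S" "g (cell x) = g (cell y)" for x y
          using bij_betw_imp_inj_on[OF g] cell that by (meson inj_onD)
        then have "diam_n n {x \<in> S. (g \<circ> cell) x = i} \<le> real n * (D / real_of_int m)"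
          using False close by (intro diam_le) auto
        then show ?thesis using small unfolding D_def by linarith
      qed simp
    qed
  qed
  then show ?thesis by blast
qed

lemma borsuk_partitionable_borsuk_f:
  assumes "S \<subseteq> Rn n" "bounded_n n S" "x \<in> S" "y \<in> S" "x \<noteq> y"
  shows "borsuk_partitionable n S (borsuk_f n)"
  using LeastI_ex[OF ex_borsuk_bound[of n], folded borsuk_f_def] assms by blast

section \<open>Vectors of equal norm with nonnegative inner products\<close>

lemma edist_sqrt_inner:
  assumes "(\<Sum>i<n. x i * x i) = r" "(\<Sum>i<n. y i * y i) = r"
  shows "edist n x y = sqrt (2 * r - 2 * (\<Sum>i<n. x i * y i))"
proof -
  have "(\<Sum>i<n. (x i - y i)^2) = (\<Sum>i<n. x i * x i + y i * y i - 2 * (x i * y i))"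
    by (intro sum.cong) (auto simp: power2_eq_square algebra_simps)
  also have "\<dots> = 2 * r - 2 * (\<Sum>i<n. x i * y i)"
    using assms by (simp add: sum_subtractf sum.distrib sum_distrib_left)
  finally show ?thesis unfolding edist_def by simp
qed

text \<open>No distance exceeds \<open>sqrt (2 * r)\<close>, and exactly the orthogonal pairs attain
  it. A part of smaller diameter thus contains no orthogonal pair and weighs at most
  \<open>m\<close>; summing over the parts gives the bound. Weights allow parts of different nature
  to be counted on the same scale.\<close>

lemma borsuk_f_weight_bound:
  fixes w :: "'a \<Rightarrow> nat \<Rightarrow> real" and wt :: "'a \<Rightarrow> nat"
  assumes fin: "finite W"
    and Rn: "\<And>a. a \<in> W \<Longrightarrow> w a \<in> Rn n"
    and norm: "\<And>a. a \<in> W \<Longrightarrow> (\<Sum>i<n. w a i * w a i) = r"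
    and nonneg: "\<And>a b. a \<in> W \<Longrightarrow> b \<in> W \<Longrightarrow> 0 \<le> (\<Sum>i<n. w a i * w b i)"
    and orth: "p \<in> W" "q \<in> W" "(\<Sum>i<n. w p i * w q i) = 0" and r: "0 < r"
    and weight: "\<And>T. T \<subseteq> W \<Longrightarrow>
        (\<And>a b. a \<in> T \<Longrightarrow> b \<in> T \<Longrightarrow> a \<noteq> b \<Longrightarrow> (\<Sum>i<n. w a i * w b i) \<noteq> 0) \<Longrightarrow> sum wt T \<le> m"
  shows "sum wt W \<le> m * borsuk_f n"
proof -
  let ?S = "w ` W" and ?D = "sqrt (2 * r)"
  have dist: "edist n (w a) (w b) = sqrt (2 * r - 2 * (\<Sum>i<n. w a i * w b i))"
    if "a \<in> W" "b \<in> W" for a b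
    using edist_sqrt_inner norm that by blast
  have le: "edist n x y \<le> ?D" if "x \<in> ?S" "y \<in> ?S" for x y
    using that dist nonneg by auto
  then have bdd: "bounded_n n ?S" unfolding bounded_n_def by blast
  \<comment> \<open>Equality would make the inner product \<open>r > 0\<close> instead of 0.\<close>
  have "w p \<noteq> w q" using orth norm[of p] r by auto
  then have "borsuk_partitionable n ?S (borsuk_f n)"
    using orth Rn by (intro borsuk_partitionable_borsuk_f[OF _ bdd, of "w p" "w q"]) auto
  then obtain c where c: "\<forall>x\<in>?S. c x < borsuk_f n"
    and diam: "\<forall>i<borsuk_f n.
      {x \<in> ?S. c x = i} = {} \<or> diam_n n {x \<in> ?S. c x = i} < diam_n n ?S"
    unfolding borsuk_partitionable_def by (elim exE conjE)
  have diam_S: "diam_n n ?S \<le> ?D" using orth le by (intro diam_le) auto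
  have cls: "sum wt {a \<in> W. c (w a) = i} \<le> m" if "i < borsuk_f n" for i
  proof (rule weight)
    fix a b assume ab: "a \<in> {a \<in> W. c (w a) = i}" "b \<in> {a \<in> W. c (w a) = i}"
    have "edist n (w a) (w b) \<le> diam_n n {x \<in> ?S. c x = i}"
      using ab by (intro edist_le_diam bounded_n_subset[OF bdd]) auto
    also have "\<dots> < ?D" using diam[rule_format, OF that] diam_S ab by auto
    finally show "(\<Sum>i<n. w a i * w b i) \<noteq> 0" using dist ab by auto
  qed auto
  have "sum wt W = (\<Sum>i<borsuk_f n. sum wt {a \<in> W. c (w a) = i})"
    using fin c by (intro sum.group[symmetric]) auto
  also have "\<dots> \<le> (\<Sum>i<borsuk_f n. m)" by (intro sum_mono cls) auto
  finally show ?thesis by (simp add: mult.commute)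
qed

text \<open>Splitting off the normalised column of a nonzero diagonal entry leaves a symmetric
  idempotent of trace one less.\<close>

lemma idempotent_gram:
  fixes Q :: "'a \<Rightarrow> 'a \<Rightarrow> real"
  assumes "finite V"
    and "\<And>a b. a \<in> V \<Longrightarrow> b \<in> V \<Longrightarrow> Q a b = Q b a"
    and "\<And>a b. a \<in> V \<Longrightarrow> b \<in> V \<Longrightarrow> (\<Sum>c\<in>V. Q a c * Q c b) = Q a b"
    and "(\<Sum>a\<in>V. Q a a) = real d"
  shows "\<exists>v. \<forall>a\<in>V. \<forall>b\<in>V. (\<Sum>i<d. v a i * v b i) = Q a b"
  using assms(2-)
proof (induction d arbitrary: Q)
  case (0 Q)
  \<comment> \<open>Diagonal entries are sums of squares along rows, so trace zero kills first the
    diagonal and then every row.\<close>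
  have sq: "Q a a = (\<Sum>c\<in>V. (Q a c)^2)" if "a \<in> V" for a
    unfolding 0(2)[OF that that, symmetric] power2_eq_square using 0(1) that
    by (intro sum.cong) auto
  then have "\<forall>a\<in>V. Q a a = 0"
    using 0(3) assms(1) sum_nonneg_eq_0_iff[of V "\<lambda>a. Q a a"] by (simp add: sum_nonneg)
  then have "\<forall>a\<in>V. \<forall>b\<in>V. Q a b = 0"
    using sq assms(1) by (simp add: sum_nonneg_eq_0_iff)
  then show ?case by simp
next
  case (Suc d Q)
  have sq: "Q a a = (\<Sum>c\<in>V. Q c a * Q c a)" if "a \<in> V" for a
    unfolding Suc.prems(2)[OF that that, symmetric] using Suc.prems(1) that
    by (intro sum.cong) auto
  obtain p where p: "p \<in> V" "Q p p \<noteq> 0"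
  proof (rule ccontr)
    assume "\<not> thesis"
    then have "(\<Sum>a\<in>V. Q a a) = 0" using that by (intro sum.neutral) blast
    then show False using Suc.prems(3) by simp
  qed
  have pos: "0 < Q p p" using sq[OF p(1)] p(2) by (simp add: less_le sum_nonneg)
  \<comment> \<open>\<open>u\<close> is a unit vector fixed by \<open>Q\<close>; this makes
    \<open>Q - u u^T\<close> idempotent and lowers the trace by 1.\<close>
  define u where "u a = Q a p / sqrt (Q p p)" for a
  have uu: "u a * u b = Q a p * Q b p / Q p p" for a b
    using pos unfolding u_def by (simp add: field_simps)
  have Qu: "(\<Sum>c\<in>V. Q a c * u c) = u a" if "a \<in> V" for a
    unfolding u_def using Suc.prems(2)[OF that p(1)] by (simp add: sum_divide_distrib[symmetric])
  have u1: "(\<Sum>c\<in>V. u c * u c) = 1"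
    unfolding uu using sq[OF p(1)] pos by (simp add: sum_divide_distrib[symmetric])
  define R where "R a b = Q a b - u a * u b" for a b
  have "\<exists>v. \<forall>a\<in>V. \<forall>b\<in>V. (\<Sum>i<d. v a i * v b i) = R a b"
  proof (rule Suc.IH)
    show "R a b = R b a" if "a \<in> V" "b \<in> V" for a b
      using Suc.prems(1)[OF that] by (simp add: R_def mult.commute)
    show "(\<Sum>c\<in>V. R a c * R c b) = R a b" if ab: "a \<in> V" "b \<in> V" for a b
    proof -
      have "(\<Sum>c\<in>V. R a c * R c b) = (\<Sum>c\<in>V. Q a c * Q c b) - (\<Sum>c\<in>V. Q a c * u c) * u b
          - u a * (\<Sum>c\<in>V. Q c b * u c) + u a * (\<Sum>c\<in>V. u c * u c) * u b"
        unfolding R_def sum_distrib_left sum_distrib_right sum_subtractf[symmetric] sum.distrib[symmetric]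
        by (intro sum.cong) (auto simp: algebra_simps)
      also have "(\<Sum>c\<in>V. Q c b * u c) = (\<Sum>c\<in>V. Q b c * u c)"
        using Suc.prems(1) ab by (intro sum.cong) auto
      finally show ?thesis
        by (simp only: Qu[OF ab(1)] Qu[OF ab(2)] u1 Suc.prems(2)[OF ab] R_def mult_1_right diff_add_cancel add_diff_cancel)
    qed
    show "(\<Sum>a\<in>V. R a a) = real d"
      using Suc.prems(3) u1 by (simp add: R_def sum_subtractf)
  qed
  then obtain v where v: "\<And>a b. a \<in> V \<Longrightarrow> b \<in> V \<Longrightarrow> (\<Sum>i<d. v a i * v b i) = R a b" by blast
  \<comment> \<open>The split-off vector \<open>u\<close> becomes the last coordinate.\<close>
  define v' where "v' a i = (if i < d then v a i else u a)" for a and i :: nat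
  have "(\<Sum>i<Suc d. v' a i * v' b i) = Q a b" if "a \<in> V" "b \<in> V" for a b
    using v[OF that] by (simp add: v'_def R_def)
  then show ?case by blast
qed


section \<open>A strongly regular graph with parameters (416, 100, 36, 20)\<close>

text \<open>The 65 points are those of the Hermitian curve \<open>x^5 + y^5 + z^5 = 0\<close> in \<open>PG(2,16)\<close>, numbered so
  that an element of order 13 of \<open>PSU(3,4)\<close> rotates five cycles of length 13; \<open>sigma\<close> lists
  its inverse, and \<open>tau\<close> is an involution of the curve. Each of the 416 orthogonal bases of the plane gives a
  block, the 15 points on the sides of that triangle, encoded by its characteristic vector. The
  exponents in \<open>blocks\<close> trace a path through the 32 orbits of \<open>sigma\<close> on the blocks.\<close>

definition act :: "nat list \<Rightarrow> bool list \<Rightarrow> bool list" where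
  "act p xs = map (\<lambda>i. xs ! i) p"

definition sigma :: "nat list" where
  "sigma =
   [12, 0, 1, 2, 3, 4, 5, 6, 7, 8, 9, 10, 11, 25, 13, 14, 15, 16, 17, 18, 19, 20, 21, 22, 23,
    24, 38, 26, 27, 28, 29, 30, 31, 32, 33, 34, 35, 36, 37, 51, 39, 40, 41, 42, 43, 44, 45, 46,
    47, 48, 49, 50, 64, 52, 53, 54, 55, 56, 57, 58, 59, 60, 61, 62, 63]"

definition tau :: "nat list" where
  "tau =
   [62, 52, 4, 47, 2, 38, 60, 64, 35, 11, 42, 9, 59, 29, 31, 43, 24, 26, 50, 56, 30, 55, 39,
    34, 16, 46, 17, 45, 41, 13, 20, 14, 48, 44, 23, 8, 53, 58, 5, 22, 61, 28, 10, 15, 33, 27,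
    25, 3, 32, 63, 18, 51, 1, 36, 57, 21, 19, 54, 37, 12, 6, 40, 0, 49, 7]"

definition base_block :: "bool list" where
  "base_block =
   map (\<lambda>i. i \<in> set [0, 6, 13, 23, 24, 26, 35, 38, 39, 40, 47, 55, 58, 59, 60]) [0..<65]"

definition cap :: "bool list \<Rightarrow> bool list \<Rightarrow> nat" where
  "cap xs ys = length (filter id (map2 (\<and>) xs ys))"

definition adj :: "bool list \<Rightarrow> bool list \<Rightarrow> bool" where
  "adj xs ys \<longleftrightarrow> cap xs ys = 3"

primrec walk :: "nat list \<Rightarrow> bool list \<Rightarrow> bool list list" where
  "walk [] x = [x]"
| "walk (e # es) x = x # walk es (act tau ((act sigma ^^ e) x))"

primrec iterates :: "nat \<Rightarrow> ('a \<Rightarrow> 'a) \<Rightarrow> 'a \<Rightarrow> 'a list" where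
  "iterates 0 f x = []"
| "iterates (Suc n) f x = x # iterates n f (f x)"

definition blocks :: "bool list list" where
  "blocks = concat (map (iterates 13 (act sigma))
     (walk [11, 11, 5, 1, 1, 2, 5, 1, 9, 8, 1, 1, 6, 3, 3, 2, 4, 9, 3, 1, 2, 1, 3, 11, 1, 1, 11, 2, 4, 6, 11]
        base_block))"

section \<open>Evaluation by rewriting\<close>

lemma base_block_eq: "base_block =
   [True, False, False, False, False, False, True, False, False, False, False, False, False,
    True, False, False, False, False, False, False, False, False, False, True, True, False,
    True, False, False, False, False, False, False, False, False, True, False, False, True,
    True, True, False, False, False, False, False, False, True, False, False, False, False,
    False, False, False, True, False, False, True, True, True, False, False, False, False]"
  unfolding base_block_def by (simp add: upt_rec)

text \<open>With 65 symbolic entries, applying the permutation is one rewrite step instead of 65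
  list lookups.\<close>

lemma act_sigma: "act sigma
   [x0, x1, x2, x3, x4, x5, x6, x7, x8, x9, x10, x11, x12, x13, x14, x15, x16, x17, x18, x19,
    x20, x21, x22, x23, x24, x25, x26, x27, x28, x29, x30, x31, x32, x33, x34, x35, x36, x37,
    x38, x39, x40, x41, x42, x43, x44, x45, x46, x47, x48, x49, x50, x51, x52, x53, x54, x55,
    x56, x57, x58, x59, x60, x61, x62, x63, x64] =
   [x12, x0, x1, x2, x3, x4, x5, x6, x7, x8, x9, x10, x11, x25, x13, x14, x15, x16, x17, x18,
    x19, x20, x21, x22, x23, x24, x38, x26, x27, x28, x29, x30, x31, x32, x33, x34, x35, x36,
    x37, x51, x39, x40, x41, x42, x43, x44, x45, x46, x47, x48, x49, x50, x64, x52, x53, x54,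
    x55, x56, x57, x58, x59, x60, x61, x62, x63]"
  by (simp add: act_def sigma_def)

lemma act_tau: "act tau
   [x0, x1, x2, x3, x4, x5, x6, x7, x8, x9, x10, x11, x12, x13, x14, x15, x16, x17, x18, x19,
    x20, x21, x22, x23, x24, x25, x26, x27, x28, x29, x30, x31, x32, x33, x34, x35, x36, x37,
    x38, x39, x40, x41, x42, x43, x44, x45, x46, x47, x48, x49, x50, x51, x52, x53, x54, x55,
    x56, x57, x58, x59, x60, x61, x62, x63, x64] =
   [x62, x52, x4, x47, x2, x38, x60, x64, x35, x11, x42, x9, x59, x29, x31, x43, x24, x26, x50,
    x56, x30, x55, x39, x34, x16, x46, x17, x45, x41, x13, x20, x14, x48, x44, x23, x8, x53,
    x58, x5, x22, x61, x28, x10, x15, x33, x27, x25, x3, x32, x63, x18, x51, x1, x36, x57, x21,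
    x19, x54, x37, x12, x6, x40, x0, x49, x7]"
  by (simp add: act_def tau_def)

lemma funpow_Suc_apply: "(f ^^ Suc n) x = f ((f ^^ n) x)"
  by simp

lemma cap_eval:
  "cap [] ys = 0"
  "cap (False # xs) (y # ys) = cap xs ys"
  "cap (True # xs) (False # ys) = cap xs ys"
  "cap (True # xs) (True # ys) = Suc (cap xs ys)"
  by (simp_all add: cap_def)

lemma adj_eval: "adj xs ys \<longleftrightarrow> cap xs ys = Suc (Suc (Suc 0))"
  by (simp add: adj_def numeral_3_eq_3)

text \<open>Comparison of two blocks stops at the first position where they differ.\<close>

lemma bool_list_eq_eval:
  "True # xs = True # ys \<longleftrightarrow> xs = ys"
  "False # xs = False # ys \<longleftrightarrow> xs = ys"
  "True # xs = False # ys \<longleftrightarrow> False"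
  "False # xs = True # ys \<longleftrightarrow> False"
  by simp_all

text \<open>The simplifier would evaluate both branches of the conditional in the defining equation of
  \<^const>\<open>filter\<close>; \<open>cons_if\<close> evaluates the tail once.\<close>

fun cons_if :: "bool \<Rightarrow> 'a \<Rightarrow> 'a list \<Rightarrow> 'a list" where
  "cons_if True x xs = x # xs"
| "cons_if False x xs = xs"

lemma filter_eval:
  "filter P [] = []"
  "filter P (x # xs) = cons_if (P x) x (filter P xs)"
  by (cases "P x"; simp)+

lemma length_eval: "length [] = 0" "length (x # xs) = Suc (length xs)"
  by simp_all

primrec memb :: "'a \<Rightarrow> 'a list \<Rightarrow> bool" where
  "memb x [] \<longleftrightarrow> False"
| "memb x (y # ys) \<longleftrightarrow> x = y \<or> memb x ys"

lemma memb_iff: "memb x ys \<longleftrightarrow> x \<in> set ys"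
  by (induction ys) auto

lemma distinct_eval:
  "distinct [] \<longleftrightarrow> True"
  "distinct (x # xs) \<longleftrightarrow> \<not> memb x xs \<and> distinct xs"
  by (simp_all add: memb_iff)

primrec maps_into :: "('a \<Rightarrow> 'a) \<Rightarrow> 'a list \<Rightarrow> 'a list \<Rightarrow> bool" where
  "maps_into f ys [] \<longleftrightarrow> True"
| "maps_into f ys (x # xs) \<longleftrightarrow> memb (f x) ys \<and> maps_into f ys xs"

lemma maps_into_iff: "maps_into f ys xs \<longleftrightarrow> f ` set xs \<subseteq> set ys"
  by (induction xs) (auto simp: memb_iff)

text \<open>These are the parameters lambda = 36 and mu = 20, selected once the adjacency test has
  been evaluated to a truth value.\<close>

fun common :: "bool \<Rightarrow> nat" where
  "common True = 36"
| "common False = 20"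

text \<open>With \<open>ns\<close> the list of neighbours of \<open>x\<close>, the filter counts
  common neighbours of \<open>x\<close> and \<open>y\<close>.\<close>

primrec common_check :: "bool list \<Rightarrow> bool list list \<Rightarrow> bool list list \<Rightarrow> bool" where
  "common_check x ns [] \<longleftrightarrow> True"
| "common_check x ns (y # ys) \<longleftrightarrow>
     length (filter (adj y) ns) = common (adj x y) \<and> common_check x ns ys"

lemma common_check_iff:
  "common_check x ns ys \<longleftrightarrow>
     (\<forall>y\<in>set ys. length (filter (adj y) ns) = common (adj x y))"
  by (induction ys) auto

fun has_clique :: "('a \<Rightarrow> 'a \<Rightarrow> bool) \<Rightarrow> nat \<Rightarrow> 'a list \<Rightarrow> bool" where
  "has_clique r 0 xs \<longleftrightarrow> True"
| "has_clique r (Suc k) [] \<longleftrightarrow> False"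
| "has_clique r (Suc k) (x # xs) \<longleftrightarrow> has_clique r k (filter (r x) xs) \<or> has_clique r (Suc k) xs"

text \<open>Numerals become towers of \<open>Suc\<close>, whose equations are settled by injectivity
  and distinctness of constructors.\<close>

lemmas arith_eval = eval_nat_numeral BitM.simps One_nat_def nat.inject nat.distinct simp_thms

lemmas blocks_eval = blocks_def base_block_eq walk.simps iterates.simps act_sigma act_tau
  funpow_0 funpow_Suc_apply concat.simps append.simps list.map arith_eval

lemmas graph_eval = blocks_eval adj_eval cap_eval filter_eval cons_if.simps bool_list_eq_eval
  memb.simps maps_into.simps list.sel length_eval

text \<open>Common neighbours and cliques need only be examined at \<^const>\<open>base_block\<close>: the two
  permutations preserve intersection sizes and act transitively on the blocks.\<close>

lemma distinct_blocks: "distinct blocks"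
  by (simp only: graph_eval distinct_eval)

lemma length_blocks: "length blocks = 416"
  by (simp only: graph_eval)

lemma tl_blocks: "blocks = base_block # tl blocks"
  by (simp only: blocks_eval list.sel)

lemma sigma_blocks: "maps_into (act sigma) blocks blocks"
  by (simp only: graph_eval)

lemma tau_blocks: "maps_into (act tau) blocks blocks"
  by (simp only: graph_eval)

lemma degree_base: "length (filter (adj base_block) blocks) = 100"
  by (simp only: graph_eval)

text \<open>The head \<open>base_block\<close> is left out: with itself it has 100 common
  neighbours, its degree.\<close>

lemma common_base: "common_check base_block (filter (adj base_block) blocks) (tl blocks)"
  by (simp only: graph_eval common.simps common_check.simps)

lemma cap_base: "cap base_block base_block = 15"
  by (simp only: graph_eval)

text \<open>A 6-clique through \<open>base_block\<close> would leave five pairwise adjacent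
  neighbours of it.\<close>

lemma no_clique_base: "\<not> has_clique adj 5 (filter (adj base_block) blocks)"
  by (simp only: graph_eval has_clique.simps)

section \<open>Symmetry and cliques\<close>

text \<open>If the head lies in \<open>T\<close>, the rest of \<open>T\<close> survives the filter;
  otherwise \<open>T\<close> lies in the tail. A failed search therefore excludes cliques of that
  size.\<close>

lemma has_clique_complete:
  assumes "T \<subseteq> set xs" "card T = k" "finite T"
    and "\<And>a b. a \<in> T \<Longrightarrow> b \<in> T \<Longrightarrow> a \<noteq> b \<Longrightarrow> r a b"
  shows "has_clique r k xs"
  using assms
proof (induction r k xs arbitrary: T rule: has_clique.induct)
  case (3 r k x xs)
  show ?case
  proof (cases "x \<in> T")
    case True
    have "has_clique r k (filter (r x) xs)"
    proof (rule "3.IH"(1))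
      show "T - {x} \<subseteq> set (filter (r x) xs)" using "3.prems" True by auto
      show "card (T - {x}) = k" using "3.prems" True by simp
    qed (use "3.prems" in auto)
    then show ?thesis by simp
  next
    case False
    have "has_clique r (Suc k) xs"
      by (rule "3.IH"(2)) (use "3.prems" False in auto)
    then show ?thesis by simp
  qed
qed auto

text \<open>As a sum over positions, \<open>cap\<close> is visibly symmetric and invariant under
  reindexing by a permutation.\<close>

lemma cap_eq_sum:
  assumes "length xs = length ys"
  shows "cap xs ys = (\<Sum>i<length xs. of_bool (xs ! i \<and> ys ! i))"
  using assms
  by (induction xs ys rule: list_induct2)
    (auto simp: cap_def sum.lessThan_Suc_shift simp del: sum.lessThan_Suc)

lemma cap_commute: "length xs = length ys \<Longrightarrow> cap xs ys = cap ys xs"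
  by (simp add: cap_eq_sum conj_commute)

definition perm_list :: "nat list \<Rightarrow> bool" where
  "perm_list p \<longleftrightarrow> length p = 65 \<and> distinct p \<and> set p \<subseteq> {..<65}"

lemma perm_list_set: "perm_list p \<Longrightarrow> set p = {..<65}"
  by (intro card_subset_eq) (auto simp: perm_list_def distinct_card)

lemma perm_list_bij:
  assumes "perm_list p"
  shows "bij_betw ((!) p) {..<65} {..<65}"
  using assms perm_list_set[OF assms] by (intro bij_betw_nth) (auto simp: perm_list_def)

lemma length_act [simp]: "length (act p xs) = length p"
  by (simp add: act_def)

lemma cap_act:
  assumes "perm_list p" "length xs = 65" "length ys = 65"
  shows "cap (act p xs) (act p ys) = cap xs ys"
proof -
  have "cap (act p xs) (act p ys) = (\<Sum>i<65. of_bool (xs ! (p ! i) \<and> ys ! (p ! i)))"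
    using assms(1) by (simp add: cap_eq_sum perm_list_def act_def)
  also have "\<dots> = (\<Sum>i<65. of_bool (xs ! i \<and> ys ! i))"
    by (rule sum.reindex_bij_betw[OF perm_list_bij[OF assms(1)]])
  finally show ?thesis using assms by (simp add: cap_eq_sum)
qed

lemma act_inj:
  assumes "perm_list p"
  shows "inj_on (act p) {xs. length xs = 65}"
proof (rule inj_onI, clarify)
  fix xs ys :: "bool list"
  assume "length xs = 65" "length ys = 65" "act p xs = act p ys"
  moreover from this have "\<forall>i\<in>set p. xs ! i = ys ! i" by (simp add: act_def)
  ultimately show "xs = ys" using perm_list_set[OF assms] by (auto intro: nth_equalityI)
qed

lemma perm_list_sigma: "perm_list sigma" and perm_list_tau: "perm_list tau"
  by (simp_all add: perm_list_def sigma_def tau_def)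

text \<open>Every block was produced from \<open>base_block\<close> by a word in
  \<open>sigma\<close> and \<open>tau\<close>, so transitivity is built into the
  enumeration.\<close>

lemma blocks_induct [consumes 1, case_names base sigma tau]:
  assumes "b \<in> set blocks" and base: "P base_block"
    and sigma: "\<And>x. P x \<Longrightarrow> P (act sigma x)" and tau: "\<And>x. P x \<Longrightarrow> P (act tau x)"
  shows "P b"
proof -
  have pow: "P ((act sigma ^^ e) x)" if "P x" for e x
    using that by (induction e) (auto intro: sigma)
  have "P y" if "y \<in> set (walk es x)" "P x" for es x y
    using that by (induction es arbitrary: x) (auto intro: tau pow)
  moreover have "P y" if "y \<in> set (iterates n (act sigma) x)" "P x" for n x y
    using that by (induction n arbitrary: x) (auto intro: sigma)
  ultimately show ?thesis using assms(1) base unfolding blocks_def set_concat set_map by blast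
qed

lemma card_blocks: "card (set blocks) = 416"
  using distinct_card[OF distinct_blocks] length_blocks by simp

lemma length_block: "b \<in> set blocks \<Longrightarrow> length b = 65"
  by (induction rule: blocks_induct)
    (use perm_list_sigma perm_list_tau in \<open>auto simp: base_block_def perm_list_def\<close>)

lemma cap_self: "b \<in> set blocks \<Longrightarrow> cap b b = 15"
proof -
  assume "b \<in> set blocks"
  \<comment> \<open>The length is carried along because \<open>cap_act\<close> requires it.\<close>
  then have "length b = 65 \<and> cap b b = 15"
    by (induction rule: blocks_induct)
      (use perm_list_sigma perm_list_tau cap_base in
        \<open>auto simp: base_block_def cap_act perm_list_def\<close>)
  then show ?thesis ..
qed

lemma adj_irrefl: "b \<in> set blocks \<Longrightarrow> \<not> adj b b"
  by (simp add: adj_def cap_self)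

lemma adj_commute: "a \<in> set blocks \<Longrightarrow> b \<in> set blocks \<Longrightarrow> adj a b = adj b a"
  by (simp add: adj_def cap_commute length_block)

lemma base_block_in: "base_block \<in> set blocks"
  using tl_blocks by (metis list.set_intros(1))

section \<open>Transitivity on the blocks, parameters and clique number\<close>

definition automorphism :: "(bool list \<Rightarrow> bool list) \<Rightarrow> bool" where
  "automorphism f \<longleftrightarrow> bij_betw f (set blocks) (set blocks) \<and>
     (\<forall>a\<in>set blocks. \<forall>b\<in>set blocks. adj (f a) (f b) = adj a b)"

text \<open>Permuting positions is injective, and an injective map of a finite set into itself is
  onto.\<close>

lemma automorphism_act:
  assumes "perm_list p" "maps_into (act p) blocks blocks"
  shows "automorphism (act p)"
proof -
  have "inj_on (act p) (set blocks)"
    by (rule inj_on_subset[OF act_inj[OF assms(1)]]) (auto simp: length_block)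
  then have "bij_betw (act p) (set blocks) (set blocks)"
    using assms(2) endo_inj_surj[of "set blocks" "act p"]
    by (simp add: maps_into_iff bij_betw_def)
  then show ?thesis
    using assms(1) by (simp add: automorphism_def adj_def cap_act length_block)
qed

lemma automorphism_comp:
  "automorphism f \<Longrightarrow> automorphism g \<Longrightarrow> automorphism (g \<circ> f)"
  unfolding automorphism_def by (auto intro: bij_betw_trans simp: bij_betwE)

lemma automorphism_transitive:
  assumes "b \<in> set blocks"
  obtains f where "automorphism f" "f base_block = b"
proof -
  have step: "\<exists>f. automorphism f \<and> f base_block = g x"
    if "automorphism g" "\<exists>f. automorphism f \<and> f base_block = x" for g x
    using that automorphism_comp[of _ g] by (metis comp_apply)
  have "\<exists>f. automorphism f \<and> f base_block = b"
    using assms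
  proof (induction rule: blocks_induct)
    case base
    have "automorphism id" by (simp add: automorphism_def)
    then show ?case by (metis id_apply)
  next
    case (sigma x)
    show ?case by (rule step[OF automorphism_act[OF perm_list_sigma sigma_blocks] sigma])
  next
    case (tau x)
    show ?case by (rule step[OF automorphism_act[OF perm_list_tau tau_blocks] tau])
  qed
  then show thesis using that by blast
qed

lemma card_filter_blocks: "card {c \<in> set blocks. P c} = length (filter P blocks)"
  using distinct_card[OF distinct_filter[OF distinct_blocks]] by simp

lemma common_base_block:
  assumes "b \<in> set blocks"
  shows "card {c \<in> set blocks. adj base_block c \<and> adj b c} =
    (if b = base_block then 100 else if adj base_block b then 36 else 20)"
proof (cases "b = base_block")
  case True
  then show ?thesis using degree_base by (simp add: card_filter_blocks)
next
  case False
  then have "b \<in> set (tl blocks)" using assms tl_blocks by (metis set_ConsD)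
  then have "length (filter (adj b) (filter (adj base_block) blocks)) = common (adj base_block b)"
    using common_base by (auto simp: common_check_iff)
  then show ?thesis
    using False by (cases "adj base_block b") (simp_all add: card_filter_blocks conj_commute)
qed

text \<open>An automorphism taking \<open>base_block\<close> to \<open>a\<close> maps the common
  neighbours of \<open>base_block\<close> and the preimage of \<open>b\<close> bijectively onto
  those of \<open>a\<close> and \<open>b\<close>.\<close>

lemma card_common:
  assumes "a \<in> set blocks" "b \<in> set blocks"
  shows "card {c \<in> set blocks. adj a c \<and> adj b c} =
    (if a = b then 100 else if adj a b then 36 else 20)"
proof -
  obtain f where f: "automorphism f" "f base_block = a"
    using automorphism_transitive[OF assms(1)] by blast
  then have bij: "bij_betw f (set blocks) (set blocks)"
    and pres: "\<And>x y. x \<in> set blocks \<Longrightarrow> y \<in> set blocks \<Longrightarrow> adj (f x) (f y) = adj x y"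
    by (auto simp: automorphism_def)
  obtain b' where b': "b' \<in> set blocks" "f b' = b"
    using bij assms(2) by (metis bij_betw_def imageE)
  have inj: "inj_on f (set blocks)" and im: "f ` set blocks = set blocks"
    using bij by (auto simp: bij_betw_def)
  have "{c \<in> set blocks. adj a c \<and> adj b c}
      = f ` {c \<in> set blocks. adj base_block c \<and> adj b' c}"
  proof (intro equalityI subsetI)
    fix c assume c: "c \<in> {c \<in> set blocks. adj a c \<and> adj b c}"
    then obtain c' where "c' \<in> set blocks" "c = f c'" using im by blast
    then show "c \<in> f ` {c \<in> set blocks. adj base_block c \<and> adj b' c}"
      using c pres[OF base_block_in] pres[OF b'(1)] f(2) b'(2) by auto
  next
    fix c assume "c \<in> f ` {c \<in> set blocks. adj base_block c \<and> adj b' c}"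
    then show "c \<in> {c \<in> set blocks. adj a c \<and> adj b c}"
      using pres[OF base_block_in] pres[OF b'(1)] f(2) b'(2) im by auto
  qed
  then have "card {c \<in> set blocks. adj a c \<and> adj b c}
      = card {c \<in> set blocks. adj base_block c \<and> adj b' c}"
    using inj by (simp add: card_image inj_on_subset)
  moreover have "b' = base_block \<longleftrightarrow> a = b"
    using inj b' base_block_in f(2) by (metis inj_on_contraD)
  moreover have "adj base_block b' = adj a b"
    using pres[OF base_block_in b'(1)] f(2) b'(2) by simp
  ultimately show ?thesis using common_base_block[OF b'(1)] by simp
qed

text \<open>A 6-clique could be pulled back along an automorphism to one through
  \<open>base_block\<close>, contradicting the computed search.\<close>

lemma clique_le_5:
  assumes "T \<subseteq> set blocks"
    and "\<And>a b. a \<in> T \<Longrightarrow> b \<in> T \<Longrightarrow> a \<noteq> b \<Longrightarrow> adj a b"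
  shows "card T \<le> 5"
proof (rule ccontr)
  assume "\<not> card T \<le> 5"
  then have "6 \<le> card T" by simp
  then obtain U where U: "U \<subseteq> T" "card U = 6" "finite U"
    by (rule obtain_subset_with_card_n)
  then obtain a where a: "a \<in> U" by fastforce
  obtain f where f: "automorphism f" "f base_block = a"
    using automorphism_transitive a U(1) assms(1) by blast
  then have inj: "inj_on f (set blocks)" and im: "f ` set blocks = set blocks"
    and pres: "\<And>x y. x \<in> set blocks \<Longrightarrow> y \<in> set blocks \<Longrightarrow> adj (f x) (f y) = adj x y"
    by (auto simp: automorphism_def bij_betw_def)
  define W where "W = {c \<in> set blocks. f c \<in> U}"
  have "U \<subseteq> f ` set blocks" using U(1) assms(1) im by simp
  then have "f ` W = U" unfolding W_def by blast
  moreover have "inj_on f W" by (rule inj_on_subset[OF inj]) (auto simp: W_def)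
  ultimately have cardW: "card W = 6" using U(2) card_image by metis
  have base: "base_block \<in> W" using a f(2) base_block_in by (simp add: W_def)
  have clique: "adj x y" if "x \<in> W" "y \<in> W" "x \<noteq> y" for x y
  proof -
    have "f x \<noteq> f y" using that inj unfolding W_def by (metis (mono_tags) inj_on_contraD mem_Collect_eq)
    then have "adj (f x) (f y)" using that U(1) assms(2) by (auto simp: W_def)
    then show ?thesis using that pres by (auto simp: W_def)
  qed
  have "has_clique adj 5 (filter (adj base_block) blocks)"
  proof (rule has_clique_complete[where T = "W - {base_block}"])
    show "W - {base_block} \<subseteq> set (filter (adj base_block) blocks)"
      using clique[OF base] by (auto simp: W_def)
    show "card (W - {base_block}) = 5" using base cardW by simp
    show "finite (W - {base_block})" by (simp add: W_def)
  qed (use clique in auto)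
  then show False using no_clique_base by simp
qed

section \<open>The Euclidean representation\<close>

text \<open>The orthogonal projection onto the eigenspace of the eigenvalue 20 is
  \<open>(A + 4 I) / 24 - J / 96\<close>; it has trace 65.\<close>

lemma blocks_projection:
  fixes Q :: "bool list \<Rightarrow> bool list \<Rightarrow> real"
  defines "Q \<equiv> \<lambda>a b. (16 * of_bool (a = b) + 4 * of_bool (adj a b) - 1) / 96"
  assumes a: "a \<in> set blocks" and b: "b \<in> set blocks"
  shows "(\<Sum>c\<in>set blocks. Q a c * Q c b) = Q a b"
proof -
  let ?V = "set blocks"
  have card: "(\<Sum>c\<in>?V. of_bool (P c)) = real (card {c \<in> ?V. P c})" for P
    by (simp add: of_bool_def sum.inter_filter[symmetric])
  have deg: "(\<Sum>c\<in>?V. of_bool (adj x c)) = (100 :: real)" if "x \<in> ?V" for x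
    unfolding card using card_common[OF that that] by simp
  \<comment> \<open>This is \<open>A^2 = 20 J + 80 I + 16 A\<close>, from 100 = 20 + 80 on the
    diagonal and 36 = 20 + 16 on edges.\<close>
  have com: "(\<Sum>c\<in>?V. of_bool (adj a c) * of_bool (adj b c))
      = (20 + 80 * of_bool (a = b) + 16 * of_bool (adj a b) :: real)"
    unfolding of_bool_conj[symmetric] card using card_common[OF a b] adj_irrefl[OF b] by auto
  have sa: "(\<Sum>c\<in>?V. of_bool (a = c) * g c) = g a" for g :: "_ \<Rightarrow> real"
    using a by (simp add: of_bool_def if_distrib[of "\<lambda>x. x * _"] sum.delta cong: if_cong)
  have sb: "(\<Sum>c\<in>?V. of_bool (b = c) * g c) = g b" for g :: "_ \<Rightarrow> real"
    using b by (simp add: of_bool_def if_distrib[of "\<lambda>x. x * _"] sum.delta cong: if_cong)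
  have "(\<Sum>c\<in>?V. Q a c * Q c b) * 96\<^sup>2 =
      (\<Sum>c\<in>?V. (16 * of_bool (a = c) + 4 * of_bool (adj a c) - 1)
        * (16 * of_bool (b = c) + 4 * of_bool (adj b c) - 1))"
    unfolding sum_distrib_right Q_def
    by (intro sum.cong) (use adj_commute b in \<open>auto simp: power2_eq_square\<close>)
  \<comment> \<open>Terms containing a Kronecker delta are grouped so that \<open>sa\<close> and
    \<open>sb\<close> collapse their sums.\<close>
  also have "\<dots> = (\<Sum>c\<in>?V. of_bool (a = c) * (256 * of_bool (b = c) + 64 * of_bool (adj b c) - 16)
      + of_bool (b = c) * (64 * of_bool (adj a c) - 16)
      + 16 * (of_bool (adj a c) * of_bool (adj b c)) - 4 * of_bool (adj a c) - 4 * of_bool (adj b c) + 1)"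
    by (intro sum.cong) (auto simp: algebra_simps)
  also have "\<dots> = 256 * of_bool (b = a) + 64 * of_bool (adj b a) - 16
      + (64 * of_bool (adj a b) - 16)
      + 16 * (20 + 80 * of_bool (a = b) + 16 * of_bool (adj a b)) - 4 * 100 - 4 * 100 + 416"
    unfolding sum.distrib sum_subtractf sa sb sum_distrib_left[symmetric] com deg[OF a] deg[OF b]
    by (simp add: card_blocks)
  also have "\<dots> = Q a b * 96\<^sup>2"
    using adj_commute[OF a b] by (auto simp: Q_def power2_eq_square)
  finally show ?thesis by simp
qed

lemma blocks_gram:
  "\<exists>x :: bool list \<Rightarrow> nat \<Rightarrow> real. (\<forall>a. x a \<in> Rn 66) \<and>
    (\<forall>a\<in>set blocks. \<forall>b\<in>set blocks.
      (\<Sum>i<66. x a i * x b i) = (if a = b then 4 else if adj a b then 1 else 0))"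
proof -
  define Q :: "bool list \<Rightarrow> bool list \<Rightarrow> real" where
    "Q a b = (16 * of_bool (a = b) + 4 * of_bool (adj a b) - 1) / 96" for a b
  have "(\<Sum>a\<in>set blocks. Q a a) = (\<Sum>a\<in>set blocks. 15 / 96)"
    by (intro sum.cong) (auto simp: Q_def adj_irrefl)
  also have "\<dots> = real 65" by (simp add: card_blocks)
  finally have "\<exists>v. \<forall>a\<in>set blocks. \<forall>b\<in>set blocks. (\<Sum>i<65::nat. v a i * v b i) = Q a b"
    by (intro idempotent_gram)
      (use blocks_projection adj_commute in \<open>auto simp: Q_def\<close>)
  then obtain v where
    v: "\<And>a b. a \<in> set blocks \<Longrightarrow> b \<in> set blocks \<Longrightarrow> (\<Sum>i<65::nat. v a i * v b i) = Q a b" by blast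
  \<comment> \<open>Since \<open>A + 4 I = 24 Q + J / 4\<close>, the vectors of \<open>Q\<close> are
    scaled by \<open>sqrt 24\<close> and a constant coordinate 1/2 supplies
    \<open>J / 4\<close>.\<close>
  define x where "x a i = (if i < 65 then sqrt 24 * v a i else if i = 65 then 1 / 2 else 0)"
    for a and i :: nat
  show ?thesis
  proof (intro exI[of _ x] conjI allI ballI)
    show "x a \<in> Rn 66" for a by (simp add: Rn_def x_def)
    fix a b assume ab: "a \<in> set blocks" "b \<in> set blocks"
    have "(\<Sum>i<66. x a i * x b i) = (\<Sum>i<65. x a i * x b i) + x a 65 * x b 65"
      using sum.lessThan_Suc[of "\<lambda>i. x a i * x b i" 65] by simp
    also have "(\<Sum>i<65. x a i * x b i) = (\<Sum>i<65. 24 * (v a i * v b i))"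
      by (intro sum.cong) (auto simp: x_def)
    also have "\<dots> = 24 * Q a b" using v[OF ab] by (simp add: sum_distrib_left[symmetric])
    finally show "(\<Sum>i<66. x a i * x b i) = (if a = b then 4 else if adj a b then 1 else 0)"
      using adj_irrefl[OF ab(1)] by (auto simp: x_def Q_def)
  qed
qed

section \<open>The lower bound in every dimension from 66 on\<close>

lemma borsuk_f_lower_bound:
  assumes n: "66 \<le> n"
  shows "n + 18 \<le> borsuk_f n"
proof -
  obtain x where xRn: "\<And>a. x a \<in> Rn 66"
    and gram: "\<And>a b. a \<in> set blocks \<Longrightarrow> b \<in> set blocks \<Longrightarrow>
      (\<Sum>i<66. x a i * x b i) = (if a = b then 4 else if adj a b then 1 else 0)"
    using blocks_gram by blast
  define w where "w = case_sum x (\<lambda>j i. if i = j then 2 else 0 :: real)"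
  define W where "W = set blocks <+> {66..<n}"
  \<comment> \<open>A new vector fills a part alone, so it gets weight 5, the bound on the size of a
    clique.\<close>
  define wt :: "bool list + nat \<Rightarrow> nat" where "wt = case_sum (\<lambda>_. 1) (\<lambda>_. 5)"
  have x0: "x a i = 0" if "66 \<le> i" for a i using xRn[of a] that by (simp add: Rn_def)
  have ll: "(\<Sum>i<n. w (Inl a) i * w (Inl b) i) = (if a = b then 4 else if adj a b then 1 else 0)"
    if "a \<in> set blocks" "b \<in> set blocks" for a b
  proof -
    have "(\<Sum>i<n. x a i * x b i) = (\<Sum>i<66. x a i * x b i)"
      using n x0 by (intro sum.mono_neutral_right) auto
    then show ?thesis using gram[OF that] by (simp add: w_def)
  qed
  have lr: "(\<Sum>i<n. w (Inl a) i * w (Inr j) i) = 0" if "66 \<le> j" for a j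
    using x0 that by (intro sum.neutral) (auto simp: w_def)
  have rl: "(\<Sum>i<n. w (Inr j) i * w (Inl a) i) = 0" if "66 \<le> j" for a j
    using lr[OF that, of a] by (simp add: mult.commute)
  have rr: "(\<Sum>i<n. w (Inr j) i * w (Inr k) i) = (if j = k then 4 else 0)" if "j < n" for j k
  proof -
    have "(\<Sum>i<n. w (Inr j) i * w (Inr k) i) = (\<Sum>i<n. if i = j then (if j = k then 4 else 0) else 0)"
      by (intro sum.cong) (auto simp: w_def)
    then show ?thesis using that by simp
  qed
  \<comment> \<open>Degree 100 leaves a vertex not adjacent to \<open>base_block\<close>. This gives
    an orthogonal pair even for \<open>n = 66\<close>, when no vectors are adjoined.\<close>
  have "card {c \<in> set blocks. adj base_block c} = 100"
    using common_base_block[OF base_block_in] by simp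
  then have "{c \<in> set blocks. adj base_block c} \<union> {base_block} \<noteq> set blocks"
    using card_blocks card_insert_le_m1[of 101 "{c \<in> set blocks. adj base_block c}" base_block] by auto
  then obtain q where q: "q \<in> set blocks" "\<not> adj base_block q" "q \<noteq> base_block"
    using base_block_in by blast
  have "sum wt W \<le> 5 * borsuk_f n"
  proof (rule borsuk_f_weight_bound[where w = w and r = 4 and p = "Inl base_block" and q = "Inl q"])
    show "finite W" by (simp add: W_def)
    show "w a \<in> Rn n" if "a \<in> W" for a
      using that n x0 by (auto simp: W_def w_def Rn_def)
    show "(\<Sum>i<n. w a i * w a i) = 4" if "a \<in> W" for a
      using that ll rr by (auto simp: W_def)
    show "0 \<le> (\<Sum>i<n. w a i * w b i)" if "a \<in> W" "b \<in> W" for a b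
      using that ll lr rl rr by (auto simp: W_def)
    show "Inl base_block \<in> W" "Inl q \<in> W" using base_block_in q by (auto simp: W_def)
    show "(\<Sum>i<n. w (Inl base_block) i * w (Inl q) i) = 0" using ll base_block_in q by auto
    fix T assume T: "T \<subseteq> W"
      and no: "\<And>a b. a \<in> T \<Longrightarrow> b \<in> T \<Longrightarrow> a \<noteq> b \<Longrightarrow> (\<Sum>i<n. w a i * w b i) \<noteq> 0"
    show "sum wt T \<le> 5"
    proof (cases "\<exists>j. Inr j \<in> T")
      case True
      then obtain j where j: "Inr j \<in> T" by blast
      \<comment> \<open>A new vector is orthogonal to every other vector of the
        configuration.\<close>
      have "b = Inr j" if "b \<in> T" for b
      proof (rule ccontr)
        assume "b \<noteq> Inr j"
        moreover have "(\<Sum>i<n. w (Inr j) i * w b i) = 0"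
          using \<open>b \<noteq> Inr j\<close> T j that rl rr by (cases b) (auto simp: W_def)
        ultimately show False using no[OF j that] by simp
      qed
      then have "T = {Inr j}" using j by blast
      then show ?thesis by (simp add: wt_def)
    next
      case False
      define U where "U = {a. Inl a \<in> T}"
      have TU: "T = Inl ` U" using False unfolding U_def by (auto simp: image_iff) (metis sum.exhaust)
      have U: "U \<subseteq> set blocks" using T by (auto simp: U_def W_def)
      have "card U \<le> 5"
      proof (rule clique_le_5[OF U])
        fix a b assume ab: "a \<in> U" "b \<in> U" "a \<noteq> b"
        then have "a \<in> set blocks" "b \<in> set blocks" using U by auto
        then show "adj a b" using ab no[of "Inl a" "Inl b"] ll[of a b]
          by (auto simp: U_def split: if_splits)
      qed
      then show ?thesis unfolding TU by (simp add: sum.reindex wt_def)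
    qed
  qed simp
  moreover have "sum wt W = 416 + 5 * (n - 66)"
    by (simp add: W_def sum.Plus wt_def card_blocks)
  \<comment> \<open>Since 5 * 83 = 415 < 416, the blocks contribute 84 after division by 5.\<close>
  ultimately show ?thesis using n by simp
qed

theorem theorem1:
  shows "borsuk_f 321 \<ge> 333 \<and> (\<forall>n\<ge>321. borsuk_f n > n + 1)"
proof (intro conjI allI impI)
  \<comment> \<open>The general bound gives 339 here.\<close>
  show "333 \<le> borsuk_f 321" using borsuk_f_lower_bound[of 321] by simp
  show "n + 1 < borsuk_f n" if "321 \<le> n" for n using borsuk_f_lower_bound[of n] that by simp
qed

end
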